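(* Every instance $(G,D,\Delta)$ of DiTGR in which $G=(U,V,E)$ is a directed bipartite graph with vertex set $U\sqcup V$ and $E\subseteq (U\times V)\cup(V\times U)$, and in which the period is $\Delta=2$, is feasible.
   Context: All graphs are finite. A $\Delta$-periodic labeling of a directed graph with edge set $E$ is a map $\lambda:E\to\{0,1,\dots,\Delta-1\}$; edge $e$ is then active exactly at the times $\lambda(e)+i\Delta$, $i\in\mathbb{N}_0$. A temporal $s$-$z$-path is a sequence $(v_{i-1},v_i,t_i)_{i=1}^{\ell}$ with $v_0=s$, $v_\ell=z$, pairwise distinct vertices $v_0,\dots,v_\ell$, $(v_{i-1},v_i)\in E$ active at time $t_i$ for every $i$, and $t_1<t_2<\dots<t_\ell$ (strictly increasing). Its duration is $t_\ell+1-t_1$. A fastest temporal path is one of minimum duration. $\hat d(u,v)$ is the distance from $u$ to $v$ in the static graph $G$ (all edges have unit length). An instance of DiTGR is a triple $(G,D,\Delta)$ with $G$ a directed, strongly connected graph, $D$ a matrix indexed by pairs of vertices with entries positive integers or $\infty$ (no restriction) such that $D_{u,v}\ge\hat d(u,v)$ for all vertices $u,v$, and $\Delta$ a positive integer. It is feasible if there is a $\Delta$-periodic labeling $\lambda$ of $E$ such that, for all vertices $u,v$, the duration of a fastest temporal path from $u$ to $v$ is at most $D_{u,v}$. Diagonal entries of $D$ play no role; all conditions on $D$ are for distinct vertices. Antiparallel edges may get different labels. *)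

theory Defs
  imports "Graph_Theory.Graph_Theory" "HOL-Library.Extended_Nat"
begin

text \<open>
  Static distance is the shortest-path cost under unit weights. The diagonal of the matrix
  is left unconstrained.
\<close>

definition ditgr_instance :: "'a pair_pre_digraph \<Rightarrow> ('a \<Rightarrow> 'a \<Rightarrow> enat) \<Rightarrow> nat \<Rightarrow> bool" where
  "ditgr_instance G D \<Delta> \<longleftrightarrow>
     pair_fin_digraph G \<and> strongly_connected (with_proj G) \<and> 0 < \<Delta> \<and>
     (\<forall>u \<in> pverts G. \<forall>v \<in> pverts G. u \<noteq> v \<longrightarrow>
        0 < D u v \<and> wf_digraph.\<mu> (with_proj G) (\<lambda>_. 1) u v \<le> ereal_of_enat (D u v))"

definition periodic_labeling :: "'a pair_pre_digraph \<Rightarrow> nat \<Rightarrow> ('a \<times> 'a \<Rightarrow> nat) \<Rightarrow> bool" where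
  "periodic_labeling G \<Delta> lab \<longleftrightarrow> (\<forall>e \<in> parcs G. lab e < \<Delta>)"

definition active_at :: "nat \<Rightarrow> ('a \<times> 'a \<Rightarrow> nat) \<Rightarrow> 'a \<times> 'a \<Rightarrow> nat \<Rightarrow> bool" where
  "active_at \<Delta> lab e t \<longleftrightarrow> (\<exists>i. t = lab e + i * \<Delta>)"

text \<open>
  A step \<open>((v, w), t)\<close> traverses the edge \<open>(v, w)\<close> at time \<open>t\<close>.  The library predicate
  \<open>apath\<close> says that consecutive edges of \<open>G\<close> lead from \<open>s\<close> to \<open>z\<close> through pairwise
  distinct vertices.
\<close>

type_synonym 'a temporal_walk = "(('a \<times> 'a) \<times> nat) list"

definition temporal_path ::
  "'a pair_pre_digraph \<Rightarrow> nat \<Rightarrow> ('a \<times> 'a \<Rightarrow> nat) \<Rightarrow> 'a \<Rightarrow> 'a \<Rightarrow> 'a temporal_walk \<Rightarrow> bool" where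
  "temporal_path G \<Delta> lab s z P \<longleftrightarrow>
     pre_digraph.apath (with_proj G) s (map fst P) z \<and>
     (\<forall>(e, t) \<in> set P. active_at \<Delta> lab e t) \<and>
     sorted_wrt (<) (map snd P)"

text \<open>Only meaningful for nonempty \<open>P\<close>, that is, for paths with distinct end vertices.\<close>

definition duration :: "'a temporal_walk \<Rightarrow> nat" where
  "duration P = snd (last P) + 1 - snd (hd P)"

definition fastest_temporal_path ::
  "'a pair_pre_digraph \<Rightarrow> nat \<Rightarrow> ('a \<times> 'a \<Rightarrow> nat) \<Rightarrow> 'a \<Rightarrow> 'a \<Rightarrow> 'a temporal_walk \<Rightarrow> bool" where
  "fastest_temporal_path G \<Delta> lab s z P \<longleftrightarrow> is_arg_min duration (temporal_path G \<Delta> lab s z) P"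

definition ditgr_feasible :: "'a pair_pre_digraph \<Rightarrow> ('a \<Rightarrow> 'a \<Rightarrow> enat) \<Rightarrow> nat \<Rightarrow> bool" where
  "ditgr_feasible G D \<Delta> \<longleftrightarrow>
     (\<exists>lab. periodic_labeling G \<Delta> lab \<and>
       (\<forall>u \<in> pverts G. \<forall>v \<in> pverts G. u \<noteq> v \<longrightarrow>
          (\<exists>P. fastest_temporal_path G \<Delta> lab u v P \<and> enat (duration P) \<le> D u v)))"

definition directed_bipartite :: "'a pair_pre_digraph \<Rightarrow> 'a set \<Rightarrow> 'a set \<Rightarrow> bool" where
  "directed_bipartite G U V \<longleftrightarrow>
     pverts G = U \<union> V \<and> U \<inter> V = {} \<and> parcs G \<subseteq> (U \<times> V) \<union> (V \<times> U)"

end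

theory Submission
  imports Defs
begin

text \<open>
  Activate the arcs leaving \<open>U\<close> at even times and those leaving \<open>V\<close> at odd times. The arcs of a
  walk leave \<open>U\<close> and \<open>V\<close> alternately, so a walk can be traversed with no waiting time, and a
  shortest path in \<open>G\<close> becomes a temporal path whose duration is the distance.
\<close>

definition side_label :: "'a set \<Rightarrow> 'a \<times> 'a \<Rightarrow> nat" where
  "side_label U e = (if fst e \<in> U then 0 else 1)"

lemma periodic_labeling_side_label: "periodic_labeling G 2 (side_label U)"
  by (simp add: periodic_labeling_def side_label_def)

lemma active_at_side_label:
  "active_at 2 (side_label U) e t \<longleftrightarrow> (even t \<longleftrightarrow> fst e \<in> U)"
  by (auto simp: active_at_def side_label_def elim!: evenE oddE) presburger+

text \<open>Crossing an arc changes the side, and one time unit changes the parity. So the invariant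
  that the current time is even exactly when the current vertex lies in \<open>U\<close> passes
  along the walk.\<close>

lemma active_at_consecutive_times:
  assumes "directed_bipartite G U V"
    and "pre_digraph.cas (with_proj G) u p v" and "set p \<subseteq> parcs G"
    and "even a \<longleftrightarrow> u \<in> U"
  shows "\<forall>(e, t) \<in> set (zip p [a..<a + length p]). active_at 2 (side_label U) e t"
  using assms(2-)
proof (induction p arbitrary: u a)
  case Nil
  then show ?case by simp
next
  case (Cons e p)
  have e: "fst e = u" "pre_digraph.cas (with_proj G) (snd e) p v"
    using Cons.prems(1) by (simp_all add: pre_digraph.cas.simps)
  have "e \<in> U \<times> V \<union> V \<times> U" "U \<inter> V = {}"
    using assms(1) Cons.prems(2) by (auto simp: directed_bipartite_def)
  then have "even (Suc a) \<longleftrightarrow> snd e \<in> U"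
    using Cons.prems(3) e(1) by auto
  then have "\<forall>(e, t) \<in> set (zip p [Suc a..<Suc a + length p]). active_at 2 (side_label U) e t"
    using Cons.prems(2) by (intro Cons.IH[OF e(2)]) auto
  \<comment> \<open>The induction peels off the first time, whereas \<open>upt_Suc\<close> would
    split the interval at its upper end.\<close>
  moreover have "[a..<a + length (e # p)] = a # [Suc a..<Suc a + length p]"
    by (simp add: upt_conv_Cons del: upt_Suc)
  moreover have "active_at 2 (side_label U) e a"
    using Cons.prems(3) e(1) by (simp add: active_at_side_label)
  ultimately show ?case
    by (simp del: upt_Suc)
qed

lemma temporal_path_of_apath:
  assumes "directed_bipartite G U V"
    and "pre_digraph.apath (with_proj G) u p v" and "p \<noteq> []"
  obtains P where "temporal_path G 2 (side_label U) u v P" "duration P = length p"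
proof
  \<comment> \<open>The earliest time at which the arcs leaving \<open>u\<close> are active.\<close>
  define a :: nat where "a = (if u \<in> U then 0 else 1)"
  define P where "P = zip p [a..<a + length p]"
  have "pre_digraph.cas (with_proj G) u p v" "set p \<subseteq> parcs G"
    using assms(2) by (auto simp: pre_digraph.apath_def pre_digraph.awalk_def)
  then have "\<forall>(e, t) \<in> set P. active_at 2 (side_label U) e t"
    unfolding P_def
    by (rule active_at_consecutive_times[OF assms(1)]) (simp add: a_def)
  moreover have "map fst P = p" "map snd P = [a..<a + length p]"
    by (simp_all add: P_def)
  ultimately show "temporal_path G 2 (side_label U) u v P"
    using assms(2) by (simp add: temporal_path_def del: upt_Suc)
  \<comment> \<open>The last departure is at \<open>a + length p - 1\<close>; the extra unit in
    \<open>duration\<close> makes up for the -1.\<close>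
  have "P \<noteq> []" "last P = (last p, a + length p - 1)" "hd P = (hd p, a)"
    using assms(3) by (auto simp: P_def last_zip hd_zip)
  then show "duration P = length p"
    using assms(3) by (cases p) (auto simp: duration_def)
qed

text \<open>Durations are natural numbers, so a minimum is attained. Hence any sufficiently short
  temporal path is enough for feasibility.\<close>

lemma fastest_temporal_path_exists:
  assumes "temporal_path G \<Delta> lab u v P"
  obtains Q where "fastest_temporal_path G \<Delta> lab u v Q" "duration Q \<le> duration P"
  using assms is_arg_min_arg_min_nat[of "temporal_path G \<Delta> lab u v" P duration]
  unfolding fastest_temporal_path_def is_arg_min_linorder by blast

text \<open>With unit weights the cost of a walk is its length, so there are no negative cycles and
  the infimum \<open>\<mu>\<close> is attained by a path.\<close>

lemma (in fin_digraph) unit_distance_attained: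
  assumes "u \<rightarrow>\<^sup>* v"
  obtains p where "apath u p v" "\<mu> (\<lambda>_. 1) u v = ereal (length p)"
proof -
  have cost: "awalk_cost (\<lambda>_. 1) p = length p" for p :: "'b list"
    by (induction p) simp_all
  show ?thesis
    using no_neg_cyc_reach_imp_path[OF assms, of "\<lambda>_. 1"] that by (auto simp: cost)
qed

theorem corollary9:
  fixes G :: "'a pair_pre_digraph" and U V :: "'a set"
    and D :: "'a \<Rightarrow> 'a \<Rightarrow> enat" and \<Delta> :: nat
  assumes "ditgr_instance G D \<Delta>"
    and "directed_bipartite G U V"
    and "\<Delta> = 2"
  shows "ditgr_feasible G D \<Delta>"
proof -
  interpret pair_fin_digraph G
    using assms(1) by (simp add: ditgr_instance_def)
  have "\<exists>P. fastest_temporal_path G 2 (side_label U) u v P \<and> enat (duration P) \<le> D u v"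
    if uv: "u \<in> pverts G" "v \<in> pverts G" "u \<noteq> v" for u v
  proof -
    have "u \<rightarrow>\<^sup>*\<^bsub>with_proj G\<^esub> v"
      using assms(1) uv by (auto simp: ditgr_instance_def strongly_connected_def)
    then obtain p where p: "apath u p v" "\<mu> (\<lambda>_. 1) u v = ereal (length p)"
      by (rule unit_distance_attained)
    have "ereal (length p) \<le> ereal_of_enat (D u v)"
      using assms(1) uv unfolding ditgr_instance_def p(2)[symmetric] by blast
    \<comment> \<open>The bound moves from extended reals back to \<open>enat\<close>, which covers
      infinite entries of \<open>D\<close> too.\<close>
    then have len: "enat (length p) \<le> D u v"
      by (metis ereal_of_enat_le_iff ereal_of_enat_simps(1))
    have "p \<noteq> []"
      using p(1) uv(3) by (auto simp: apath_Nil_iff)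
    then obtain P where P: "temporal_path G 2 (side_label U) u v P" "duration P = length p"
      using temporal_path_of_apath[OF assms(2) p(1)] by blast
    obtain Q where "fastest_temporal_path G 2 (side_label U) u v Q" "duration Q \<le> duration P"
      using fastest_temporal_path_exists[OF P(1)] .
    then show ?thesis
      using P(2) len by (metis enat_ord_simps(1) order_trans)
  qed
  then show ?thesis
    unfolding ditgr_feasible_def assms(3) using periodic_labeling_side_label by blast
qed

end
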